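(* In the online resource allocation problem described in the context, suppose the assumption on rewards and sizes and the regularity assumption on the distribution functions $F_i$ hold. Then the expected reward of the prophet satisfies $$\mathbb E[V^{\text{off}}(\mathbf I)]=\Omega\bigl(T^{\frac1{1+\alpha}}\bigr),$$ where $\alpha$ is a positive constant satisfying $\frac1{\gamma_2}=\lambda^\alpha$.
   Context: **Problem.** There are $m$ resources with initial capacities $c_1,\dots,c_m$ and $T$ periods. In period $t$ one request arrives with a nonnegative reward vector $\mathbf r^t=(r^t_1,\dots,r^t_m)$ and a positive size vector $\mathbf d^t=(d^t_1,\dots,d^t_m)$; the pairs $(\mathbf r^t,\mathbf d^t)$ are drawn independently over $t$ from a distribution that does not depend on $t$. Put $\mathbf I=\{(\mathbf r^t,\mathbf d^t)\}_{t=1}^T$. The prophet value is $$V^{\text{off}}(\mathbf I)=\max\Bigl\{\sum_{t=1}^T\sum_{j=1}^mr^t_jx^t_j:\ \sum_{t=1}^Td^t_jx^t_j\le c_j\ \forall j,\ \sum_{j=1}^mx^t_j\le1\ \forall t,\ x^t_j\in\{0,1\}\Bigr\}.$$ The asymptotic statement is as $T\to\infty$, with the capacities fixed. **Assumption on rewards and sizes.** $\mathbf r^t$ takes values in a finite set $\{\mathbf r_1,\dots,\mathbf r_n\}$, $\mathbf r_i=(r_{i1},\dots,r_{im})$, and equals $\mathbf r_i$ with probability $p_i$. Given $\mathbf r^t=\mathbf r_i$, $\mathbf d^t=\mathbf b_i\cdot u^t_i$, where $\mathbf b_i=(b_{i1},\dots,b_{im})$ is a deterministic positive vector and $u^t_i$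 is a one-dimensional random variable with distribution function $F_i$. **Regularity assumption on $F_i$.** For some $\bar\omega>0$ and for all $i$, $F_i$ has a continuous density $f_i$ and: (1) there exist a constant $0<\lambda<1$ and two constants $1<\gamma_1<\gamma_2$ such that $\gamma_1F_i(\lambda w)\le F_i(w)\le\gamma_2F_i(\lambda w)$ for all $w\in(0,\bar\omega)$; (2) $w\mapsto w^3f_i(w)$ is non-decreasing on $(0,\bar\omega)$.
   Formalization: It is additionally assumed that for some type i and resource j one has p_i>0, r_ij>0, c_j>0 and F_i is not identically zero on (0, ω̄); otherwise (e.g. u_i supported on [1,2], ω̄=1, or all rewards zero) the prophet value is bounded in T and the claim fails. *)

theory Defs
  imports "HOL-Probability.Probability" "HOL-Library.Landau_Symbols"
begin

text \<open>A request is a pair of a reward vector and a size vector, indexed by the resources \<open>'m\<close>.\<close>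

type_synonym 'm request = "(real ^ 'm) \<times> (real ^ 'm)"

definition feasible ::
    "real ^ 'm::finite \<Rightarrow> nat \<Rightarrow> (nat \<Rightarrow> 'm request) \<Rightarrow> (nat \<Rightarrow> 'm \<Rightarrow> real) \<Rightarrow> bool" where
  "feasible c T I x \<longleftrightarrow>
     (\<forall>t<T. \<forall>j. x t j \<in> {0, 1}) \<and>
     (\<forall>j. (\<Sum>t<T. snd (I t) $ j * x t j) \<le> c $ j) \<and>
     (\<forall>t<T. (\<Sum>j\<in>UNIV. x t j) \<le> 1)"

text \<open>
  The maximum ranges over a finite set of values, since only the entries of \<open>x\<close> in the periods
  \<open>t < T\<close> matter; the set is nonempty when the capacities are nonnegative (take \<open>x = 0\<close>).
\<close>

definition prophet_value ::
    "real ^ 'm::finite \<Rightarrow> nat \<Rightarrow> (nat \<Rightarrow> 'm request) \<Rightarrow> real" where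
  "prophet_value c T I =
     Max {(\<Sum>t<T. \<Sum>j\<in>UNIV. fst (I t) $ j * x t j) | x. feasible c T I x}"

text \<open>
  The assumption on rewards and sizes, as a property of the law \<open>Q\<close> of a single request.
  \<open>uniform_measure Q {q. fst q = r i}\<close> is \<open>Q\<close> conditioned on the reward vector being \<open>r i\<close>, and
  \<open>\<nu>\<close> is the law of the scalar factor of the sizes of such requests.
\<close>

definition finite_reward_types ::
    "'m::finite request measure \<Rightarrow> ('n::finite \<Rightarrow> real ^ 'm) \<Rightarrow> ('n \<Rightarrow> real) \<Rightarrow>
     ('n \<Rightarrow> real ^ 'm) \<Rightarrow> ('n \<Rightarrow> real \<Rightarrow> real) \<Rightarrow> bool" where
  "finite_reward_types Q r p b F \<longleftrightarrow>
     inj r \<and>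
     (AE q in Q. fst q \<in> range r) \<and>
     (\<forall>i. measure Q {q. fst q = r i} = p i) \<and>
     (\<forall>i j. 0 < b i $ j) \<and>
     (\<forall>i. \<exists>\<nu>. real_distribution \<nu> \<and> cdf \<nu> = F i \<and>
        (0 < p i \<longrightarrow>
          distr (uniform_measure Q {q. fst q = r i}) borel snd = distr \<nu> borel (\<lambda>u. u *\<^sub>R b i)))"

text \<open>
  Sizes are positive, so continuity of the density is only required on the positive half-line;
  this admits densities that are unbounded or jump at \<open>0\<close>.
\<close>

definition has_continuous_density :: "(real \<Rightarrow> real) \<Rightarrow> (real \<Rightarrow> real) \<Rightarrow> bool" where
  "has_continuous_density F f \<longleftrightarrow>
     f \<in> borel_measurable borel \<and> (\<forall>w. 0 \<le> f w) \<and>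
     prob_space (density lborel (\<lambda>w. ennreal (f w))) \<and>
     F = cdf (density lborel (\<lambda>w. ennreal (f w))) \<and>
     continuous_on {0<..} f"

definition regular_at_zero ::
    "real \<Rightarrow> real \<Rightarrow> real \<Rightarrow> real \<Rightarrow> (real \<Rightarrow> real) \<Rightarrow> (real \<Rightarrow> real) \<Rightarrow> bool" where
  "regular_at_zero \<omega> lam \<gamma>\<^sub>1 \<gamma>\<^sub>2 F f \<longleftrightarrow>
     has_continuous_density F f \<and>
     (\<forall>w\<in>{0<..<\<omega>}. \<gamma>\<^sub>1 * F (lam * w) \<le> F w \<and> F w \<le> \<gamma>\<^sub>2 * F (lam * w)) \<and>
     mono_on {0<..<\<omega>} (\<lambda>w. w ^ 3 * f w)"

end

theory Submission imports Defs begin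

text \<open>
  A prophet who uses a single resource \<open>j\<close> and serves only requests of a single type \<open>i\<close>, and
  among these only small ones, already earns the claimed order. Call period \<open>t\<close> good if its reward
  vector is \<open>r i\<close> and its size at resource \<open>j\<close> is at most \<open>w * b i $ j\<close>. A period is good with
  probability \<open>p i * F i w\<close> (\<open>measure_small_requests\<close>), and any \<open>K \<le> c $ j / (w * b i $ j)\<close> good
  requests fit into the capacity, so the prophet earns at least \<open>r i $ j * min N K\<close>, where \<open>N\<close> is
  the number of good periods (\<open>prophet_value_ge_small_requests\<close>).

  The threshold \<open>w\<close> balances supply and capacity. Iterating \<open>F i w \<le> \<gamma>\<^sub>2 * F i (lam * w)\<close> towards
  zero gives \<open>F i w \<ge> C * w powr \<alpha>\<close> (\<open>doubling_imp_power_lower_bound\<close>), so the mean of \<open>N\<close> is at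
  least of order \<open>T * w powr \<alpha>\<close>, while \<open>K\<close> can be taken of order \<open>1 / w\<close>. With
  \<open>w = T powr (- 1 / (1 + \<alpha>))\<close> both are of order \<open>T powr (1 / (1 + \<alpha>))\<close>.

  It remains that \<open>min N K\<close> is in expectation not much smaller than the minimum of the mean of \<open>N\<close>
  and \<open>K\<close>. No concentration inequality is involved: the second moment of \<open>N\<close> suffices, since
  \<open>min N K\<close> dominates a concave quadratic polynomial in \<open>N\<close> (\<open>expectation_min_card_ge\<close>).

  The Bochner integral of a non-integrable function is \<open>0\<close>, so pointwise bounds alone say nothing
  about the expectation; \<open>integrable_prophet_value\<close> supplies the missing integrability.
\<close>

section \<open>Growth of the distribution function at zero\<close>

text \<open>
  Scaling the argument by \<open>lam\<close> costs at most the factor \<open>lam powr \<alpha>\<close>, which is exactly how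
  \<open>w powr \<alpha>\<close> scales. Hence the bound on \<open>[lam * v, v]\<close>, where it follows from
  monotonicity and the doubling condition at \<open>v\<close>, propagates to all smaller scales.
\<close>

lemma doubling_imp_power_lower_bound:
  fixes F :: "real \<Rightarrow> real"
  assumes mono: "mono F"
    and doubling: "\<And>w. 0 < w \<Longrightarrow> w \<le> v \<Longrightarrow> F w \<le> \<gamma> * F (lam * w)"
    and pos: "0 < F v" "0 < v" "0 < lam" "lam < 1" "0 < \<alpha>"
    and \<gamma>: "1 / \<gamma> = lam powr \<alpha>"
  shows "\<exists>C>0. \<forall>w. 0 < w \<longrightarrow> w \<le> v \<longrightarrow> C * w powr \<alpha> \<le> F w"
proof -
  have "0 < 1 / \<gamma>" using \<gamma> pos by simp
  then have gpos: "0 < \<gamma>" by simp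
  have step: "lam powr \<alpha> * F w \<le> F (lam * w)" if "0 < w" "w \<le> v" for w
    unfolding \<gamma>[symmetric] using doubling[OF that] gpos by (simp add: field_simps)
  \<comment> \<open>chosen so that \<open>C * v powr \<alpha> = lam powr \<alpha> * F v \<le> F (lam * v)\<close>, which settles the top scale\<close>
  define C where "C = lam powr \<alpha> * F v * v powr (- \<alpha>)"
  have Cpos: "0 < C" using pos by (simp add: C_def)
  have "C * w powr \<alpha> \<le> F w" if "lam ^ n * v \<le> w" "0 < w" "w \<le> v" for w n
    using that
  proof (induction n arbitrary: w)
    case 0
    then have w: "w = v" by simp
    have "C * w powr \<alpha> = lam powr \<alpha> * F v"
      using pos by (simp add: C_def w powr_minus field_simps)
    also have "\<dots> \<le> F (lam * v)" using step[of v] pos by simp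
    also have "\<dots> \<le> F w" using pos w by (intro monoD[OF mono]) simp
    finally show ?case .
  next
    case (Suc n)
    show ?case
    proof (cases "w \<le> lam * v")
      case True
      have wl: "w / lam \<le> v" "0 < w / lam" "lam ^ n * v \<le> w / lam"
        using True Suc.prems pos by (simp_all add: field_simps)
      have "C * w powr \<alpha> = lam powr \<alpha> * (C * (w / lam) powr \<alpha>)"
        using pos Suc.prems by (simp add: powr_divide)
      also have "\<dots> \<le> lam powr \<alpha> * F (w / lam)"
        using Suc.IH[OF wl(3,2,1)] by (intro mult_left_mono) simp_all
      also have "\<dots> \<le> F w" using step[OF wl(2,1)] pos by simp
      finally show ?thesis .
    next
      case False
      have "C * w powr \<alpha> \<le> C * v powr \<alpha>"
        using Cpos Suc.prems pos by (intro mult_left_mono powr_mono2) simp_all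
      also have "\<dots> = lam powr \<alpha> * F v"
        using pos by (simp add: C_def powr_minus field_simps)
      also have "\<dots> \<le> F (lam * v)" using step[of v] pos by simp
      also have "\<dots> \<le> F w" using False by (intro monoD[OF mono]) simp
      finally show ?thesis .
    qed
  qed
  moreover have "\<exists>n. lam ^ n * v \<le> w" if w: "0 < w" for w
  proof -
    obtain n where "lam ^ n < w / v"
      using real_arch_pow_inv[of "w / v" lam] w pos by auto
    then have "lam ^ n * v \<le> w" using pos by (simp add: field_simps)
    then show ?thesis ..
  qed
  ultimately show ?thesis using Cpos by blast
qed

section \<open>Expected truncated number of successes\<close>

text \<open>
  For \<open>0 \<le> s \<le> 1\<close> we have \<open>min N K \<ge> min (s N) K \<ge> s N - (s N)\<^sup>2 / (4 K)\<close>, the last step because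
  \<open>(s N - 2 K)\<^sup>2 \<ge> 0\<close>. Pairwise independence gives \<open>E N\<^sup>2 \<le> \<mu> (1 + \<mu>)\<close>. The damping factor \<open>s\<close>
  is what makes the bound useful when \<open>\<mu>\<close> is far above \<open>K\<close>: without it the quadratic term would
  dominate.
\<close>

lemma (in prob_space) expectation_min_card_ge:
  fixes A :: "nat \<Rightarrow> 'a set" and K q :: real and T :: nat
  assumes ev: "\<And>t. A t \<in> events"
    and prob: "\<And>t. prob (A t) = q"
    and pairwise: "\<And>s t. s \<noteq> t \<Longrightarrow> prob (A s \<inter> A t) = q * q"
    and K: "0 < K"
  defines "N \<equiv> \<lambda>\<xi>. real (card {t. t < T \<and> \<xi> \<in> A t})"
  defines "\<mu> \<equiv> real T * q"
  shows "3 / 4 * min \<mu> (K * \<mu> / (1 + \<mu>)) \<le> expectation (\<lambda>\<xi>. min (N \<xi>) K)"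
    and "integrable M (\<lambda>\<xi>. min (N \<xi>) K)"
proof -
  have N: "N \<xi> = (\<Sum>t<T. indicator (A t) \<xi>)" for \<xi>
  proof -
    have "{t. t < T \<and> \<xi> \<in> A t} = {t\<in>{..<T}. \<xi> \<in> A t}" by auto
    then show ?thesis by (simp add: N_def indicator_def sum.If_cases Int_def)
  qed
  have N2: "(N \<xi>)\<^sup>2 = (\<Sum>s<T. \<Sum>t<T. indicator (A s \<inter> A t) \<xi>)" for \<xi>
    by (simp add: N power2_eq_square sum_product indicator_inter_arith)
  have int1: "integrable M (indicator B :: 'a \<Rightarrow> real)" if "B \<in> events" for B
    using that by (simp add: integrable_real_indicator less_top[symmetric])
  have intN: "integrable M N"
    unfolding N by (intro Bochner_Integration.integrable_sum int1 ev)
  have intN2: "integrable M (\<lambda>\<xi>. (N \<xi>)\<^sup>2)"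
    unfolding N2 by (intro Bochner_Integration.integrable_sum int1 sets.Int ev)
  have EN: "expectation N = \<mu>"
    unfolding N using ev by (subst Bochner_Integration.integral_sum)
      (auto intro!: int1 simp: prob \<mu>_def Int_absorb2 sets.sets_into_space)
  have q0: "0 \<le> q" using prob[of 0] measure_nonneg[of M "A 0"] by simp
  then have \<mu>0: "0 \<le> \<mu>" by (simp add: \<mu>_def)
  have pair: "prob (A s \<inter> A t) \<le> q * q + (if s = t then q else 0)" for s t
    using pairwise[of s t] prob[of t] q0 by (cases "s = t") auto
  have "expectation (\<lambda>\<xi>. (N \<xi>)\<^sup>2) = (\<Sum>s<T. \<Sum>t<T. prob (A s \<inter> A t))"
    unfolding N2 using ev
    by (simp add: Bochner_Integration.integral_sum int1 sets.Int Int_absorb2 sets.sets_into_space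
        Bochner_Integration.integrable_sum le_infI1)
  also have "\<dots> \<le> (\<Sum>s<T. \<Sum>t<T. q * q + (if s = t then q else 0))"
    by (intro sum_mono pair)
  also have "\<dots> = \<mu>\<^sup>2 + \<mu>"
    by (simp add: sum.distrib \<mu>_def power2_eq_square algebra_simps)
  finally have EN2: "expectation (\<lambda>\<xi>. (N \<xi>)\<^sup>2) \<le> \<mu> * (1 + \<mu>)"
    by (simp add: power2_eq_square algebra_simps)
  show intmin: "integrable M (\<lambda>\<xi>. min (N \<xi>) K)"
    using intN by (intro Bochner_Integration.integrable_min) auto
  \<comment> \<open>the largest \<open>s \<le> 1\<close> for which the quadratic term is at most a quarter of the linear one\<close>
  define s where "s = min 1 (K / (1 + \<mu>))"
  have s: "0 < s" "s \<le> 1" "s * (1 + \<mu>) \<le> K"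
  proof -
    show "0 < s" "s \<le> 1" using K \<mu>0 by (auto simp: s_def)
    have "s * (1 + \<mu>) \<le> K / (1 + \<mu>) * (1 + \<mu>)"
      using \<mu>0 by (intro mult_right_mono) (auto simp: s_def)
    then show "s * (1 + \<mu>) \<le> K" using \<mu>0 by simp
  qed
  have quad: "s * N \<xi> - s\<^sup>2 / (4 * K) * (N \<xi>)\<^sup>2 \<le> min (N \<xi>) K" for \<xi>
  proof -
    have N0: "0 \<le> N \<xi>" by (simp add: N_def)
    have "0 \<le> (s * N \<xi> - 2 * K)\<^sup>2" by simp
    then have "s * N \<xi> - s\<^sup>2 / (4 * K) * (N \<xi>)\<^sup>2 \<le> K"
      using K by (simp add: field_simps power2_eq_square)
    moreover have "s * N \<xi> \<le> N \<xi>" using s N0 by (simp add: mult_left_le_one_le)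
    moreover have "0 \<le> s\<^sup>2 / (4 * K) * (N \<xi>)\<^sup>2" using K by simp
    ultimately show ?thesis by simp
  qed
  have "min \<mu> (K * \<mu> / (1 + \<mu>)) = s * \<mu>"
    using \<mu>0 by (simp add: s_def min_mult_distrib_right)
  moreover have "s\<^sup>2 / (4 * K) * (\<mu> * (1 + \<mu>)) \<le> s * \<mu> / 4"
  proof -
    have "s * \<mu> * (s * (1 + \<mu>)) \<le> s * \<mu> * K"
      using s \<mu>0 by (intro mult_left_mono) auto
    then show ?thesis using K by (simp add: field_simps power2_eq_square)
  qed
  ultimately have "3 / 4 * min \<mu> (K * \<mu> / (1 + \<mu>)) \<le> s * \<mu> - s\<^sup>2 / (4 * K) * (\<mu> * (1 + \<mu>))"
    by linarith
  also have "\<dots> \<le> s * expectation N - s\<^sup>2 / (4 * K) * expectation (\<lambda>\<xi>. (N \<xi>)\<^sup>2)"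
    unfolding EN using EN2 K by (intro diff_left_mono mult_left_mono) auto
  also have "\<dots> = expectation (\<lambda>\<xi>. s * N \<xi> - s\<^sup>2 / (4 * K) * (N \<xi>)\<^sup>2)"
    using intN intN2 by (subst Bochner_Integration.integral_diff) auto
  also have "\<dots> \<le> expectation (\<lambda>\<xi>. min (N \<xi>) K)"
    using quad intN intN2 intmin by (intro integral_mono) auto
  finally show "3 / 4 * min \<mu> (K * \<mu> / (1 + \<mu>)) \<le> expectation (\<lambda>\<xi>. min (N \<xi>) K)" .
qed

section \<open>The prophet value as a random variable\<close>

text \<open>
  A decision is encoded by the set of pairs that it accepts. Up to the irrelevant periods
  \<open>t \<ge> T\<close>, the decisions then range over a finite set that does not depend on the requests.
\<close>

definition selection :: "(nat \<times> 'm) set \<Rightarrow> nat \<Rightarrow> 'm \<Rightarrow> real" where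
  "selection S t j = of_bool ((t, j) \<in> S)"

definition reward :: "nat \<Rightarrow> (nat \<Rightarrow> 'm::finite request) \<Rightarrow> (nat \<times> 'm) set \<Rightarrow> real" where
  "reward T I S = (\<Sum>t<T. \<Sum>j\<in>UNIV. fst (I t) $ j * selection S t j)"

lemma feasible_eq_selection:
  assumes "feasible c T I x"
  obtains S where "S \<subseteq> {..<T} \<times> UNIV" "\<And>t j. t < T \<Longrightarrow> x t j = selection S t j"
proof
  show "{(t, j). t < T \<and> x t j = 1} \<subseteq> {..<T} \<times> UNIV" by auto
  show "x t j = selection {(t, j). t < T \<and> x t j = 1} t j" if "t < T" for t j
    using assms that unfolding feasible_def selection_def by auto
qed

lemma feasible_cong:
  assumes "\<And>t j. t < T \<Longrightarrow> x t j = y t j"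
  shows "feasible c T I x \<longleftrightarrow> feasible c T I y"
  using assms by (simp add: feasible_def)

text \<open>
  The set of feasible decisions varies with the requests. Since the zero decision is always
  feasible, giving infeasible decisions the value \<open>0\<close> leaves the set of attained values unchanged
  and turns the maximum into one over a fixed finite index set. Finiteness and measurability can
  be read off from this form.
\<close>

lemma prophet_value_values_eq:
  fixes c :: "real ^ 'm::finite"
  assumes c: "\<And>j. 0 \<le> c $ j"
  shows "{(\<Sum>t<T. \<Sum>j\<in>UNIV. fst (I t) $ j * x t j) | x. feasible c T I x} =
    (\<lambda>S. if feasible c T I (selection S) then reward T I S else 0) ` Pow ({..<T} \<times> UNIV)"
    (is "?L = ?R")
proof (intro equalityI subsetI)
  fix v assume "v \<in> ?L"
  then obtain x where x: "feasible c T I x" "v = (\<Sum>t<T. \<Sum>j\<in>UNIV. fst (I t) $ j * x t j)"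
    by blast
  obtain S where S: "S \<subseteq> {..<T} \<times> UNIV" "\<And>t j. t < T \<Longrightarrow> x t j = selection S t j"
    using feasible_eq_selection[OF x(1)] by blast
  have "feasible c T I (selection S)" using feasible_cong[of T x "selection S" c I] S(2) x(1) by blast
  moreover have "v = reward T I S" using S(2) by (simp add: x(2) reward_def)
  ultimately show "v \<in> ?R" using S(1) by (intro image_eqI[of _ _ S]) auto
next
  fix v assume "v \<in> ?R"
  then obtain S where S: "v = (if feasible c T I (selection S) then reward T I S else 0)"
    by blast
  have zero: "feasible c T I (\<lambda>_ _. 0)" using c by (simp add: feasible_def)
  show "v \<in> ?L"
  proof (cases "feasible c T I (selection S)")
    case True
    then show ?thesis unfolding S reward_def by auto
  next
    case False
    then show ?thesis using S zero by (auto intro!: exI[of _ "\<lambda>_ _. 0"])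
  qed
qed

lemma prophet_value_eq_Max:
  fixes c :: "real ^ 'm::finite"
  assumes "\<And>j. 0 \<le> c $ j"
  shows "prophet_value c T I =
    Max ((\<lambda>S. if feasible c T I (selection S) then reward T I S else 0) ` Pow ({..<T} \<times> UNIV))"
  unfolding prophet_value_def prophet_value_values_eq[OF assms] ..

lemma prophet_value_ge:
  fixes c :: "real ^ 'm::finite"
  assumes c: "\<And>j. 0 \<le> c $ j" and x: "feasible c T I x"
  shows "(\<Sum>t<T. \<Sum>j\<in>UNIV. fst (I t) $ j * x t j) \<le> prophet_value c T I"
  unfolding prophet_value_def
proof (rule Max_ge)
  show "finite {(\<Sum>t<T. \<Sum>j\<in>UNIV. fst (I t) $ j * x t j) | x. feasible c T I x}"
    unfolding prophet_value_values_eq[OF c] by simp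
qed (use x in blast)

lemma abs_prophet_value_le:
  fixes c :: "real ^ 'm::finite"
  assumes c: "\<And>j. 0 \<le> c $ j"
  shows "\<bar>prophet_value c T I\<bar> \<le> (\<Sum>t<T. \<Sum>j\<in>UNIV. \<bar>fst (I t) $ j\<bar>)"
proof -
  let ?v = "\<lambda>S. if feasible c T I (selection S) then reward T I S else 0"
  have "prophet_value c T I \<in> ?v ` Pow ({..<T} \<times> UNIV)"
    unfolding prophet_value_eq_Max[OF c] by (intro Max_in) auto
  then obtain S where S: "prophet_value c T I = ?v S" by blast
  have "\<bar>reward T I S\<bar> \<le> (\<Sum>t<T. \<bar>\<Sum>j\<in>UNIV. fst (I t) $ j * selection S t j\<bar>)"
    unfolding reward_def by (rule sum_abs)
  also have "\<dots> \<le> (\<Sum>t<T. \<Sum>j\<in>UNIV. \<bar>fst (I t) $ j * selection S t j\<bar>)"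
    by (intro sum_mono sum_abs)
  also have "\<dots> \<le> (\<Sum>t<T. \<Sum>j\<in>UNIV. \<bar>fst (I t) $ j\<bar>)"
    by (intro sum_mono) (simp add: selection_def)
  finally show ?thesis using S by (auto simp: sum_nonneg)
qed

lemma borel_measurable_request_components:
  fixes Y :: "'a \<Rightarrow> 'm::finite request"
  assumes "Y \<in> borel_measurable M"
  shows "(\<lambda>\<xi>. fst (Y \<xi>) $ j) \<in> borel_measurable M"
    and "(\<lambda>\<xi>. snd (Y \<xi>) $ j) \<in> borel_measurable M"
proof -
  have "(\<lambda>q::'m request. fst q $ j) \<in> borel_measurable borel"
    by (intro borel_measurable_continuous_onI continuous_intros)
  from measurable_compose[OF assms this] show "(\<lambda>\<xi>. fst (Y \<xi>) $ j) \<in> borel_measurable M" .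
  have "(\<lambda>q::'m request. snd q $ j) \<in> borel_measurable borel"
    by (intro borel_measurable_continuous_onI continuous_intros)
  from measurable_compose[OF assms this] show "(\<lambda>\<xi>. snd (Y \<xi>) $ j) \<in> borel_measurable M" .
qed

lemma borel_measurable_prophet_value:
  fixes c :: "real ^ 'm::finite" and X :: "nat \<Rightarrow> 'a \<Rightarrow> 'm request"
  assumes c: "\<And>j. 0 \<le> c $ j" and X: "\<And>t. X t \<in> borel_measurable M"
  shows "(\<lambda>\<xi>. prophet_value c T (\<lambda>t. X t \<xi>)) \<in> borel_measurable M"
proof -
  note [measurable] = borel_measurable_request_components[OF X]
  have "(\<lambda>\<xi>. if feasible c T (\<lambda>t. X t \<xi>) (selection S) then reward T (\<lambda>t. X t \<xi>) S else 0)
      \<in> borel_measurable M" for S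
    unfolding feasible_def reward_def by measurable
  then show ?thesis
    unfolding prophet_value_eq_Max[OF c] by (intro borel_measurable_Max) auto
qed

text \<open>
  Almost surely each reward vector is one of finitely many, so the total reward is bounded.
\<close>

lemma integrable_prophet_value:
  fixes c :: "real ^ 'm::finite" and X :: "nat \<Rightarrow> 'a \<Rightarrow> 'm request"
  assumes M: "prob_space M"
    and c: "\<And>j. 0 \<le> c $ j" and X: "\<And>t. X t \<in> borel_measurable M"
    and R: "finite R" "\<And>t. AE \<xi> in M. fst (X t \<xi>) \<in> R"
  shows "integrable M (\<lambda>\<xi>. prophet_value c T (\<lambda>t. X t \<xi>))"
proof -
  interpret prob_space M by fact
  define B where "B = (\<Sum>\<rho>\<in>R. \<Sum>j\<in>UNIV. \<bar>\<rho> $ j\<bar>)"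
  have "AE \<xi> in M. \<forall>t. fst (X t \<xi>) \<in> R" using R(2) by (simp add: AE_all_countable)
  then have "AE \<xi> in M. norm (prophet_value c T (\<lambda>t. X t \<xi>)) \<le> real T * B"
  proof (eventually_elim)
    case (elim \<xi>)
    have "\<bar>prophet_value c T (\<lambda>t. X t \<xi>)\<bar> \<le> (\<Sum>t<T. \<Sum>j\<in>UNIV. \<bar>fst (X t \<xi>) $ j\<bar>)"
      by (rule abs_prophet_value_le[OF c])
    also have "\<dots> \<le> (\<Sum>t<T. B)"
      unfolding B_def using elim R(1)
      by (intro sum_mono member_le_sum[of _ R "\<lambda>\<rho>. \<Sum>j\<in>UNIV. \<bar>\<rho> $ j\<bar>"]) (auto intro: sum_nonneg)
    finally show ?case by simp
  qed
  then show ?thesis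
    by (rule integrable_const_bound) (rule borel_measurable_prophet_value[OF c X])
qed

section \<open>Serving small requests of a single type\<close>

text \<open>
  The witness accepts, for resource \<open>j\<close> only, as many periods of \<open>G\<close> as possible but at most \<open>K\<close>
  of them.
\<close>

lemma prophet_value_ge_small_requests:
  fixes c :: "real ^ 'm::finite"
  assumes c: "\<And>j. 0 \<le> c $ j"
    and small: "\<And>t. t \<in> G \<Longrightarrow> \<rho> \<le> fst (I t) $ j \<and> snd (I t) $ j \<le> \<delta>"
    and G: "G \<subseteq> {..<T}"
    and cap: "real K * \<delta> \<le> c $ j" and nonneg: "0 \<le> \<rho>" "0 \<le> \<delta>"
  shows "\<rho> * min (real (card G)) (real K) \<le> prophet_value c T I"
proof -
  obtain H where H: "H \<subseteq> G" "card H = min (card G) K"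
    using obtain_subset_with_card_n[of "min (card G) K" G] by auto
  have HT: "{..<T} \<inter> H = H" using H G by auto
  define x where "x = selection (H \<times> {j})"
  have x: "x t k = (if k = j then of_bool (t \<in> H) else 0)" for t k
    by (simp add: x_def selection_def)
  have fold_sum: "(\<Sum>t<T. g t * of_bool (t \<in> H)) = sum g H" for g :: "nat \<Rightarrow> real"
    using sum.inter_restrict[of "{..<T}" g H] HT
    by (simp add: if_distrib of_bool_def cong: if_cong)
  have "(\<Sum>t\<in>H. snd (I t) $ j) \<le> (\<Sum>t\<in>H. \<delta>)"
    using small H by (intro sum_mono) auto
  also have "\<dots> \<le> real K * \<delta>"
    using H(2) nonneg by (simp add: mult_right_mono)
  finally have use: "(\<Sum>t\<in>H. snd (I t) $ j) \<le> c $ j" using cap by simp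
  have "(\<Sum>t<T. snd (I t) $ k * x t k) \<le> c $ k" for k
    using c use by (cases "k = j") (simp_all add: x fold_sum)
  then have "feasible c T I x"
    unfolding feasible_def by (simp add: x)
  from prophet_value_ge[OF c this]
  have "(\<Sum>t\<in>H. fst (I t) $ j) \<le> prophet_value c T I"
    by (simp add: x if_distrib[of "\<lambda>y. _ * y"] fold_sum cong: if_cong)
  moreover have "(\<Sum>t\<in>H. \<rho>) \<le> (\<Sum>t\<in>H. fst (I t) $ j)"
    using small H by (intro sum_mono) auto
  ultimately show ?thesis using H(2) by (simp add: of_nat_min mult.commute)
qed

text \<open>
  Given the type \<open>i\<close>, the size at resource \<open>j\<close> is \<open>u * b i $ j\<close> with \<open>u\<close> distributed according to
  \<open>F i\<close>; since \<open>b i $ j\<close> is positive, the bound on the size says \<open>u \<le> w\<close>.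
\<close>

lemma measure_small_requests:
  fixes Q :: "'m::finite request measure" and b r :: "'n::finite \<Rightarrow> real ^ 'm"
  assumes types: "finite_reward_types Q r p b F"
    and Q: "prob_space Q" "sets Q = sets borel" and p: "0 < p i"
  shows "measure Q {q. fst q = r i \<and> snd q $ j \<le> w * b i $ j} = p i * F i w"
proof -
  interpret prob_space Q by fact
  have b: "0 < b i $ j" and pi: "measure Q {q. fst q = r i} = p i"
    using types by (auto simp: finite_reward_types_def)
  obtain \<nu> where \<nu>: "real_distribution \<nu>" "cdf \<nu> = F i"
    and law: "distr (uniform_measure Q {q. fst q = r i}) borel snd = distr \<nu> borel (\<lambda>u. u *\<^sub>R b i)"
    using types p unfolding finite_reward_types_def by blast
  interpret \<nu>: real_distribution \<nu> by fact
  let ?E = "{q :: 'm request. fst q = r i}" and ?D = "{y :: real ^ 'm. y $ j \<le> w * b i $ j}"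
  have E: "?E \<in> sets Q"
    unfolding Q by (intro borel_closed closed_Collect_eq continuous_intros)
  have D: "?D \<in> sets borel"
    by (intro borel_closed closed_Collect_le continuous_intros)
  have snd: "snd \<in> borel_measurable (uniform_measure Q ?E)"
    using borel_measurable_continuous_onI[OF continuous_on_snd[OF continuous_on_id]]
    by (simp add: measurable_def Q space_borel sets_eq_imp_space_eq[OF Q(2)])
  have sD: "snd -` ?D \<in> sets Q"
    unfolding Q by (simp add: vimage_def, intro borel_closed closed_Collect_le continuous_intros)
  have scale: "(\<lambda>u. u *\<^sub>R b i) \<in> borel_measurable \<nu>"
    unfolding measurable_cong_sets[OF \<nu>.events_eq_borel refl]
    by (intro borel_measurable_continuous_onI continuous_intros)
  have "measure (distr \<nu> borel (\<lambda>u. u *\<^sub>R b i)) ?D = measure \<nu> {..w}"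
    using b by (subst measure_distr[OF scale D]) (auto intro!: arg_cong[where f = "measure \<nu>"])
  then have rhs: "measure (distr \<nu> borel (\<lambda>u. u *\<^sub>R b i)) ?D = F i w"
    using fun_cong[OF \<nu>(2), of w] by (simp add: cdf_def)
  have "measure (distr (uniform_measure Q ?E) borel snd) ?D = measure (uniform_measure Q ?E) (snd -` ?D)"
    by (subst measure_distr[OF snd D]) (simp add: space_borel sets_eq_imp_space_eq[OF Q(2)])
  also have "\<dots> = measure Q (?E \<inter> snd -` ?D) / p i"
    using E sD p pi by (subst measure_uniform_measure) (auto simp: emeasure_eq_measure)
  finally have "measure Q (?E \<inter> snd -` ?D) = p i * F i w"
    using rhs law p by (simp add: field_simps)
  moreover have "?E \<inter> snd -` ?D = {q. fst q = r i \<and> snd q $ j \<le> w * b i $ j}" by auto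
  ultimately show ?thesis by simp
qed

section \<open>Lower bound on the expected prophet value\<close>

lemma expectation_prophet_value_ge:
  fixes M :: "'a measure" and X :: "nat \<Rightarrow> 'a \<Rightarrow> 'm::finite request"
    and b r :: "'n::finite \<Rightarrow> real ^ 'm" and T :: nat
  assumes M: "prob_space M"
    and independent: "prob_space.indep_vars M (\<lambda>_. borel) X UNIV"
    and law: "\<And>t. distr M borel (X t) = Q"
    and c: "\<And>j. 0 \<le> c $ j"
    and types: "finite_reward_types Q r p b F"
    and pos: "0 < p i" "0 \<le> r i $ j" "0 < w" "0 < K"
    and cap: "real K * (w * b i $ j) \<le> c $ j"
  defines "\<mu> \<equiv> real T * (p i * F i w)"
  shows "r i $ j * (3 / 4 * min \<mu> (real K * \<mu> / (1 + \<mu>)))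
    \<le> prob_space.expectation M (\<lambda>\<xi>. prophet_value c T (\<lambda>t. X t \<xi>))"
proof -
  interpret prob_space M by fact
  have X: "X t \<in> borel_measurable M" for t
    using independent by (simp add: indep_vars_def)
  have Q: "prob_space Q" "sets Q = sets borel"
    unfolding law[of 0, symmetric] using prob_space_distr[OF X] by simp_all
  have b: "0 < b i $ j" using types by (simp add: finite_reward_types_def)
  define E where "E = {q :: 'm request. fst q = r i \<and> snd q $ j \<le> w * b i $ j}"
  define A where "A t = X t -` E \<inter> space M" for t
  have E: "E \<in> sets borel"
    unfolding E_def
    by (intro borel_closed closed_Collect_conj closed_Collect_eq closed_Collect_le continuous_intros)
  have ev: "A t \<in> events" for t
    unfolding A_def using measurable_sets[OF X E] .
  have prob: "prob (A t) = p i * F i w" for t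
    using measure_distr[OF X E, of t] law[of t] measure_small_requests[OF types Q pos(1), of j w]
    by (simp add: A_def E_def)
  have pair: "prob (A s \<inter> A t) = p i * F i w * (p i * F i w)" if "s \<noteq> t" for s t
    using indep_varsD[OF independent, of "{s, t}" "\<lambda>_. E"] E that prob[of s] prob[of t]
    by (simp add: A_def Int_ac)
  have types_AE: "AE \<xi> in M. fst (X t \<xi>) \<in> range r" for t
  proof (rule AE_distrD[OF X])
    show "AE q in distr M borel (X t). fst q \<in> range r"
      unfolding law using types by (simp add: finite_reward_types_def)
  qed
  note count = expectation_min_card_ge[of A "p i * F i w" "real K" T, OF ev prob pair]
  have int: "integrable M (\<lambda>\<xi>. prophet_value c T (\<lambda>t. X t \<xi>))"
    by (rule integrable_prophet_value[OF M c X _ types_AE]) simp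
  have "r i $ j * min (real (card {t. t < T \<and> \<xi> \<in> A t})) (real K)
      \<le> prophet_value c T (\<lambda>t. X t \<xi>)" for \<xi>
    using pos b by (intro prophet_value_ge_small_requests[OF c _ _ cap]) (auto simp: A_def E_def)
  then have "expectation (\<lambda>\<xi>. r i $ j * min (real (card {t. t < T \<and> \<xi> \<in> A t})) (real K))
      \<le> expectation (\<lambda>\<xi>. prophet_value c T (\<lambda>t. X t \<xi>))"
    using pos count(2) int
    by (intro integral_mono) auto
  moreover have "r i $ j * (3 / 4 * min \<mu> (real K * \<mu> / (1 + \<mu>)))
      \<le> expectation (\<lambda>\<xi>. r i $ j * min (real (card {t. t < T \<and> \<xi> \<in> A t})) (real K))"
    unfolding Bochner_Integration.integral_mult_right_zero \<mu>_def
    using pos count(1) by (intro mult_left_mono) auto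
  ultimately show ?thesis by linarith
qed

theorem theorem2:
  fixes M :: "'a measure"
    and X :: "nat \<Rightarrow> 'a \<Rightarrow> 'm::finite request"
    and Q :: "'m request measure"
    and c :: "real ^ 'm"
    and r b :: "'n::finite \<Rightarrow> real ^ 'm"
    and p :: "'n \<Rightarrow> real"
    and F f :: "'n \<Rightarrow> real \<Rightarrow> real"
    and \<omega> lam \<gamma>\<^sub>1 \<gamma>\<^sub>2 \<alpha> :: real
  assumes "prob_space M"
    and independent: "prob_space.indep_vars M (\<lambda>_. borel) X UNIV"
    and identically_distributed: "\<And>t. distr M borel (X t) = Q"
    and nonneg_rewards: "AE q in Q. \<forall>j. 0 \<le> fst q $ j"
    and positive_sizes: "AE q in Q. \<forall>j. 0 < snd q $ j"
    and capacities: "\<And>j. 0 \<le> c $ j"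
    and reward_types: "finite_reward_types Q r p b F"
    and "0 < \<omega>" and "0 < lam" and "lam < 1" and "1 < \<gamma>\<^sub>1" and "\<gamma>\<^sub>1 < \<gamma>\<^sub>2"
    and regular: "\<And>i. regular_at_zero \<omega> lam \<gamma>\<^sub>1 \<gamma>\<^sub>2 (F i) (f i)"
    and nondegenerate:
      "\<exists>i j. 0 < p i \<and> 0 < r i $ j \<and> 0 < c $ j \<and> (\<exists>w\<in>{0<..<\<omega>}. 0 < F i w)"
    and "0 < \<alpha>" and "1 / \<gamma>\<^sub>2 = lam powr \<alpha>"
  shows "(\<lambda>T. prob_space.expectation M (\<lambda>\<xi>. prophet_value c T (\<lambda>t. X t \<xi>)))
           \<in> \<Omega>(\<lambda>T. real T powr (1 / (1 + \<alpha>)))"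
proof -
  obtain i j v where pos: "0 < p i" "0 < r i $ j" "0 < c $ j"
    and v: "0 < v" "v < \<omega>" "0 < F i v"
    using nondegenerate by auto
  have b: "0 < b i $ j" using reward_types by (simp add: finite_reward_types_def)
  obtain \<nu> where "real_distribution \<nu>" "cdf \<nu> = F i"
    using reward_types unfolding finite_reward_types_def by blast
  then have "mono (F i)"
    using finite_borel_measure.cdf_nondecreasing[of \<nu>]
    by (auto intro!: monoI simp: real_distribution.finite_borel_measure_M)
  then obtain C where C: "0 < C" "\<And>w. 0 < w \<Longrightarrow> w \<le> v \<Longrightarrow> C * w powr \<alpha> \<le> F i w"
    using doubling_imp_power_lower_bound[of "F i" v \<gamma>\<^sub>2 lam \<alpha>] regular[of i] v assms
    by (auto simp: regular_at_zero_def)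
  define \<beta> where "\<beta> = 1 / (1 + \<alpha>)"
  have \<beta>: "0 < \<beta>" "1 - \<beta> * \<alpha> = \<beta>"
    using \<open>0 < \<alpha>\<close> by (auto simp: \<beta>_def field_simps)
  define \<kappa> where "\<kappa> = c $ j / b i $ j"
  have \<kappa>: "0 < \<kappa>" using pos b by (simp add: \<kappa>_def)
  define D where "D = r i $ j * (3 / 4 * min (p i * C) (\<kappa> / 4))"
  have D: "0 < D" using pos C(1) \<kappa> by (simp add: D_def)
  have large: "\<forall>\<^sub>F T in sequentially. B \<le> real T powr \<beta>" for B
  proof -
    have "\<forall>\<^sub>F T in sequentially. max B 1 powr (1 / \<beta>) \<le> real T"
      using filterlim_real_sequentially by (simp add: filterlim_at_top)
    then show ?thesis
    proof eventually_elim
      case (elim T)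
      have "B \<le> (max B 1 powr (1 / \<beta>)) powr \<beta>"
        using \<beta>(1) by (simp add: powr_powr)
      also have "\<dots> \<le> real T powr \<beta>"
        using elim \<beta>(1) by (intro powr_mono2) auto
      finally show ?case .
    qed
  qed
  have "\<forall>\<^sub>F T in sequentially. D * real T powr \<beta>
      \<le> prob_space.expectation M (\<lambda>\<xi>. prophet_value c T (\<lambda>t. X t \<xi>))"
    using large[of "1 / v"] large[of "2 / \<kappa>"] large[of "1 / (p i * C)"] eventually_gt_at_top[of 0]
  proof eventually_elim
    case (elim T)
    define Z where "Z = real T powr \<beta>"
    have Z: "0 < Z" "1 / v \<le> Z" "2 \<le> \<kappa> * Z" "1 \<le> p i * C * Z"
      using elim \<kappa> pos C(1) by (auto simp: Z_def field_simps)
    define w where "w = 1 / Z"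
    have w: "0 < w" "w \<le> v" using Z v by (auto simp: w_def field_simps)
    define K where "K = nat \<lfloor>\<kappa> * Z\<rfloor>"
    have K: "\<kappa> * Z - 1 \<le> real K" "real K \<le> \<kappa> * Z" using Z by (auto simp: K_def)
    then have K': "\<kappa> * Z / 2 \<le> real K" "0 < K" using Z by linarith+
    have "real K * (w * b i $ j) \<le> \<kappa> * Z * (w * b i $ j)"
      using K(2) w b by (intro mult_right_mono) auto
    also have "\<dots> = c $ j" using Z b by (simp add: w_def \<kappa>_def)
    finally have cap: "real K * (w * b i $ j) \<le> c $ j" .
    define \<mu> where "\<mu> = real T * (p i * F i w)"
    \<comment> \<open>the exponent \<open>\<beta>\<close> is the solution of \<open>\<beta> = 1 - \<alpha> * \<beta>\<close>\<close>
    have "Z = real T powr (1 - \<beta> * \<alpha>)" using \<beta>(2) by (simp add: Z_def)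
    also have "\<dots> = real T * w powr \<alpha>"
      using elim by (simp add: w_def Z_def powr_divide powr_powr powr_diff)
    finally have "p i * C * Z = real T * (p i * (C * w powr \<alpha>))" by simp
    also have "\<dots> \<le> \<mu>"
      unfolding \<mu>_def using C(2)[OF w] pos by (intro mult_left_mono) auto
    finally have \<mu>: "p i * C * Z \<le> \<mu>" .
    then have \<mu>1: "1 \<le> \<mu>" using Z by simp
    \<comment> \<open>\<open>\<mu> \<ge> 1\<close> bounds \<open>\<mu> / (1 + \<mu>)\<close> below by \<open>1 / 2\<close>; rounding \<open>K\<close> down costs the other factor \<open>2\<close>\<close>
    have "\<kappa> / 4 * Z \<le> real K * (1 / 2)" using K' by (simp add: mult.commute)
    also have "\<dots> \<le> real K * (\<mu> / (1 + \<mu>))"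
      using \<mu>1 by (intro mult_left_mono) (auto simp: field_simps)
    finally have "min (p i * C * Z) (\<kappa> / 4 * Z) \<le> min \<mu> (real K * \<mu> / (1 + \<mu>))"
      using \<mu> unfolding times_divide_eq_right by (intro min.mono) auto
    then have "min (p i * C) (\<kappa> / 4) * Z \<le> min \<mu> (real K * \<mu> / (1 + \<mu>))"
      using Z(1) unfolding min_mult_distrib_right by simp
    then have "D * Z \<le> r i $ j * (3 / 4 * min \<mu> (real K * \<mu> / (1 + \<mu>)))"
      unfolding D_def mult.assoc using pos by (intro mult_left_mono) auto
    also have "\<dots> \<le> prob_space.expectation M (\<lambda>\<xi>. prophet_value c T (\<lambda>t. X t \<xi>))"
      unfolding \<mu>_def using pos w K'
      by (intro expectation_prophet_value_ge[OF \<open>prob_space M\<close> independent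
            identically_distributed capacities reward_types _ _ _ _ cap]) auto
    finally show ?case by (simp add: Z_def)
  qed
  then show ?thesis
    using D unfolding \<beta>_def by (intro landau_omega.bigI[of D]) (auto elim!: eventually_mono)
qed

end
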